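(* Let $1\le m\le N$ be integers, let $(u_n)$ be a sequence of a.e. finite functions on $\Lambda^m$ and let $U_n=G_{m,N}(u_n)$ be the corresponding sequence of generalized $N$-means of order $m$. Then there is an a.e. finite function $U$ on $\Lambda^N$ such that $U_n\to U$ a.e. on $\Lambda^N$ if and only if there is an a.e. finite function $u$ on $\Lambda^m$ such that $u_n\to u$ a.e. on $\Lambda^m$. If so, $U=G_{m,N}(u)$ a.e.
   Context: $\Lambda$ is a set with a $\sigma$-finite complete measure $dx$, of strictly positive total measure. For $k\ge 1$, $d^kx$ is the completion of the product measure $dx^{\otimes k}$ on $\Lambda^k$; "a.e." and "null set" on $\Lambda^k$ refer to $d^kx$. Functions are (extended) real-valued and defined a.e.; "a.e. finite" means finite-valued off a null set. No measurability or symmetry of the functions is assumed. For integers $1\le m\le N$ and an a.e. finite function $u$ on $\Lambda^m$, the generalized $N$-mean of order $m$ with kernel $u$ is the a.e. defined function on $\Lambda^N$ $$G_{m,N}(u)(x_1,\dots,x_N):=\binom{N}{m}^{-1}\sum_{1\le i_1<\cdots<i_m\le N}u(x_{i_1},\dots,x_{i_m}),$$ equality being understood a.e. on $\Lambda^N$. *)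

theory Defs
  imports "HOL-Analysis.Analysis"
begin

(* Points of the k-fold power of (space M) are the extensional functions on {1..k}. *)
definition power_measure :: "'a measure \<Rightarrow> nat \<Rightarrow> (nat \<Rightarrow> 'a) measure" where
  "power_measure M k = completion (\<Pi>\<^sub>M i\<in>{1..k}. M)"

(* A function defined a.e. is represented by an arbitrary total extended-real-valued function
   extending it; all statements below depend only on values off a null set. *)
definition ae_finite :: "'a measure \<Rightarrow> nat \<Rightarrow> ((nat \<Rightarrow> 'a) \<Rightarrow> ereal) \<Rightarrow> bool" where
  "ae_finite M k f \<longleftrightarrow> (AE x in power_measure M k. \<bar>f x\<bar> \<noteq> \<infinity>)"

definition increasing_indices :: "nat \<Rightarrow> nat \<Rightarrow> (nat \<Rightarrow> nat) set" where
  "increasing_indices m N = {i \<in> {1..m} \<rightarrow>\<^sub>E {1..N}. strict_mono_on {1..m} i}"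

(* When u is infinite somewhere the sum may involve the library convention for adding opposite
   infinities; for a.e. finite u this happens only on a null set. *)
definition generalized_mean ::
    "nat \<Rightarrow> nat \<Rightarrow> ((nat \<Rightarrow> 'a) \<Rightarrow> ereal) \<Rightarrow> (nat \<Rightarrow> 'a) \<Rightarrow> ereal" where
  "generalized_mean m N u x =
     ereal (1 / real (N choose m)) *
       (\<Sum>i\<in>increasing_indices m N. u (\<lambda>j\<in>{1..m}. x (i j)))"

end

(* Write the kernel of order m+1 as u_n(y, x) with x in Lambda^m. Let j be the least first index
   occurring in the mean. Changing the j-th argument from z to y changes the mean by a sum of terms
   u_n(y, x) - u_n(z, x), so by induction on m these differences converge. Replacing every first
   argument by a fixed z then turns the mean into a nonempty sum of terms u_n(z, x) of order m, up to
   a convergent sequence, and the induction hypothesis applies again. The induction leaves the class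
   of means but stays within sums over nonempty finite families of increasing index tuples.
   Every order uses up two further points, so one runs the argument at a.e. point of
   Lambda^(N + 2m), and descends to Lambda^m by Fubini, Lambda having positive measure. *)
theory Submission
  imports Defs
begin

section \<open>Recovering a kernel from sums over increasing index tuples\<close>

text \<open>Induction on the length \<open>m\<close>, peeling off first entries. \<open>K\<close> is
  a finite stock of labels for the arguments of \<open>f\<close>; the slack \<open>2 * m\<close>
  pays for the labels withdrawn, at most two per step. \<open>A\<close> indexes the lists with
  possible repetition, since lists that differ only in their heads coincide once the heads are
  dropped.\<close>

lemma convergent_sum_listD:
  fixes f :: "nat \<Rightarrow> 'b list \<Rightarrow> real" and idx :: "'a \<Rightarrow> 'i::linorder list"
  assumes "finite A" and "A \<noteq> {}" and "finite I" and "finite K" and "card I + 2 * m \<le> card K"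
    and "\<And>a. a \<in> A \<Longrightarrow> length (idx a) = m"
    and "\<And>a. a \<in> A \<Longrightarrow> sorted_wrt (<) (idx a)"
    and "\<And>a. a \<in> A \<Longrightarrow> set (idx a) \<subseteq> I"
    and "\<And>t. inj_on t I \<Longrightarrow> t ` I \<subseteq> K \<Longrightarrow> convergent (\<lambda>n. \<Sum>a\<in>A. f n (map t (idx a)))"
    and "distinct l" and "length l = m" and "set l \<subseteq> K"
  shows "convergent (\<lambda>n. f n l)"
  using assms
proof (induction m arbitrary: f idx A K l)
  case 0
  \<comment> \<open>Some injection must exist for the convergence hypothesis to say anything. All
    lists are empty here, so the terms are equal and add up without cancellation.\<close>
  obtain t where "t ` I \<subseteq> K" "inj_on t I"
    using card_le_inj[OF \<open>finite I\<close> \<open>finite K\<close>] "0.prems"(5) by auto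
  then have "convergent (\<lambda>n. \<Sum>a\<in>A. f n (map t (idx a)))"
    using 0 by blast
  moreover have "(\<Sum>a\<in>A. f n (map t (idx a))) = real (card A) * f n []" for n
    using "0.prems"(6) by simp
  moreover have "card A \<noteq> 0" using 0 by simp
  ultimately show ?case
    using "0.prems"(11) by (simp add: convergent_mult_const_iff)
next
  case (Suc m)
  note fin = \<open>finite A\<close> and conv = Suc.prems(9)
  have Cons: "idx a = hd (idx a) # tl (idx a)" if "a \<in> A" for a
    using Suc.prems(6)[OF that] by (cases "idx a") auto
  have hd_less: "hd (idx a) < i" if "a \<in> A" "i \<in> set (tl (idx a))" for a i
    using Suc.prems(7)[OF that(1)] Cons[OF that(1)] that(2) by (metis sorted_wrt.simps(2))
  have tl_len: "length (tl (idx a)) = m" and tl_sorted: "sorted_wrt (<) (tl (idx a))"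
    and tl_I: "set (tl (idx a)) \<subseteq> I" and hd_I: "hd (idx a) \<in> I"
    and dist: "distinct (idx a)" if "a \<in> A" for a
    using Suc.prems(6-8)[OF that] by (cases "idx a"; force simp: strict_sorted_iff)+
  \<comment> \<open>Entries of a tail exceed the head of their list, which is at least
    \<open>j\<close>. So \<open>j\<close> lies in no tail, and altering \<open>t\<close> at
    \<open>j\<close> affects only the lists of \<open>A'\<close>, and those only in the first
    entry.\<close>
  define j where "j = Min ((\<lambda>a. hd (idx a)) ` A)"
  have j_le: "j \<le> hd (idx a)" if "a \<in> A" for a
    using that fin by (simp add: j_def)
  define A' where "A' = {a \<in> A. hd (idx a) = j}"
  have "j \<in> (\<lambda>a. hd (idx a)) ` A"
    unfolding j_def using Suc.prems by (intro Min_in) auto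
  then have A': "A' \<noteq> {}" "finite A'" "A' \<subseteq> A"
    using fin by (auto simp: A'_def)
  have diff: "convergent (\<lambda>n. f n (y # l) - f n (z # l))"
    if yz: "y \<in> K" "z \<in> K" "y \<noteq> z" and l: "distinct l" "length l = m" "set l \<subseteq> K - {y, z}" for y z l
  proof (rule Suc.IH[where f = "\<lambda>n l. f n (y # l) - f n (z # l)" and A = A'
        and idx = "\<lambda>a. tl (idx a)" and K = "K - {y, z}"])
    fix t assume t: "inj_on t I" "t ` I \<subseteq> K - {y, z}"
    \<comment> \<open>\<open>t\<close> avoids \<open>y\<close> and \<open>z\<close>, so sending
      \<open>j\<close> to either of them keeps it injective on \<open>I\<close>.\<close>
    have inj: "inj_on (t(j := v)) I" "t(j := v) ` I \<subseteq> K" if "v \<in> {y, z}" for v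
      using t yz that by (auto simp: inj_on_def image_subset_iff)
    have "(\<Sum>a\<in>A. f n (map (t(j := y)) (idx a))) - (\<Sum>a\<in>A. f n (map (t(j := z)) (idx a)))
        = (\<Sum>a\<in>A'. f n (y # map t (tl (idx a))) - f n (z # map t (tl (idx a))))" for n
    proof -
      have map_eq: "map (t(j := v)) (idx a)
          = (if hd (idx a) = j then v # map t (tl (idx a)) else map t (idx a))" if "a \<in> A" for a v
      proof -
        have "j \<notin> set (tl (idx a))"
          using hd_less[OF that] j_le[OF that] by force
        then have "map (t(j := v)) (tl (idx a)) = map t (tl (idx a))" by simp
        then have "map (t(j := v)) (hd (idx a) # tl (idx a))
            = (if hd (idx a) = j then v # map t (tl (idx a)) else map t (hd (idx a) # tl (idx a)))"
          by simp
        then show ?thesis using Cons[OF that] by metis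
      qed
      show ?thesis
        unfolding A'_def sum_subtractf[symmetric] sum.inter_filter[OF fin]
        by (intro sum.cong) (simp_all add: map_eq)
    qed
    then show "convergent (\<lambda>n. \<Sum>a\<in>A'. f n (y # map t (tl (idx a))) - f n (z # map t (tl (idx a))))"
      using convergent_diff[OF conv[OF inj[of y]] conv[OF inj[of z]]] by (simp del: fun_upd_apply)
  qed (use A' Suc.prems(1-5) yz l tl_len tl_sorted in \<open>auto dest: subsetD[OF tl_I] subsetD[OF A'(3)]\<close>)
  obtain z l' where l: "l = z # l'" using Suc.prems(11) by (cases l) auto
  show ?case
    unfolding l
  proof (rule Suc.IH[where f = "\<lambda>n l. f n (z # l)" and A = A
        and idx = "\<lambda>a. tl (idx a)" and K = "K - {z}"])
    fix t assume t: "inj_on t I" "t ` I \<subseteq> K - {z}"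
    \<comment> \<open>Replacing every actual head by \<open>z\<close> costs a sum of differences of
      the kind treated in \<open>diff\<close>.\<close>
    have split: "(\<Sum>a\<in>A. f n (map t (idx a)))
        - (\<Sum>a\<in>A. f n (t (hd (idx a)) # map t (tl (idx a))) - f n (z # map t (tl (idx a))))
        = (\<Sum>a\<in>A. f n (z # map t (tl (idx a))))" for n
      unfolding sum_subtractf[symmetric]
      by (intro sum.cong refl) (metis Cons diff_diff_eq2 list.simps(9) add_diff_cancel_left')
    have "convergent (\<lambda>n. \<Sum>a\<in>A. f n (t (hd (idx a)) # map t (tl (idx a))) - f n (z # map t (tl (idx a))))"
    \<comment> \<open>Here \<open>t\<close> avoids \<open>z\<close> and is injective on each list,
      so the head differs from \<open>z\<close> and the tail avoids both labels, as
      \<open>diff\<close> demands.\<close>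
    proof (rule convergent_sum, rule diff)
      fix a assume a: "a \<in> A"
      have "distinct (map t (idx a))"
        using dist[OF a] Suc.prems(8)[OF a] t(1) by (auto simp: distinct_map intro: inj_on_subset)
      then have d: "distinct (t (hd (idx a)) # map t (tl (idx a)))"
        using Cons[OF a] by (metis list.simps(9))
      then show "distinct (map t (tl (idx a)))" by simp
      show "set (map t (tl (idx a))) \<subseteq> K - {t (hd (idx a)), z}"
      proof -
        have "set (map t (tl (idx a))) \<subseteq> K - {z}" using t(2) tl_I[OF a] by auto
        moreover have "t (hd (idx a)) \<notin> set (map t (tl (idx a)))" using d by simp
        ultimately show ?thesis by blast
      qed
      show "t (hd (idx a)) \<in> K" "t (hd (idx a)) \<noteq> z" using t(2) hd_I[OF a] by auto
    qed (use l Suc.prems tl_len in auto)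
    then show "convergent (\<lambda>n. \<Sum>a\<in>A. f n (z # map t (tl (idx a))))"
      unfolding split[symmetric] using conv t by (intro convergent_diff) auto
  qed (use l Suc.prems(1-5,10-) tl_len tl_sorted in \<open>auto dest: subsetD[OF tl_I]\<close>)
qed

section \<open>Almost everywhere statements on finite powers\<close>

text \<open>The cylinder over a null set is null. As \<open>P\<close> may be nonmeasurable, its
  exceptional set is first enclosed in a measurable null set \<open>E\<close>.\<close>

lemma AE_PiM_restrict:
  assumes "sigma_finite_measure M" and "finite I" and "J \<subseteq> I"
    and "AE x in \<Pi>\<^sub>M i\<in>J. M. P x"
  shows "AE x in \<Pi>\<^sub>M i\<in>I. M. P (restrict x J)"
proof -
  interpret product_sigma_finite "\<lambda>_. M"
    using assms by (simp add: product_sigma_finite_def)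
  have fin: "finite J" "finite (I - J)" and I: "J \<union> (I - J) = I" "J \<inter> (I - J) = {}"
    using assms finite_subset by auto
  interpret D: sigma_finite_measure "\<Pi>\<^sub>M i\<in>I - J. M"
    using fin(2) by (rule sigma_finite)
  obtain E where E: "E \<in> null_sets (\<Pi>\<^sub>M i\<in>J. M)" "{x \<in> space (\<Pi>\<^sub>M i\<in>J. M). \<not> P x} \<subseteq> E"
    using assms(4) unfolding eventually_ae_filter by auto
  let ?r = "\<lambda>x. restrict x J"
  have r: "?r \<in> (\<Pi>\<^sub>M i\<in>I. M) \<rightarrow>\<^sub>M (\<Pi>\<^sub>M i\<in>J. M)"
    using \<open>J \<subseteq> I\<close> by (rule measurable_restrict_subset)
  define F where "F = ?r -` E \<inter> space (\<Pi>\<^sub>M i\<in>I. M)"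
  have F: "F \<in> sets (\<Pi>\<^sub>M i\<in>I. M)"
    using E r unfolding F_def by (auto intro: measurable_sets)
  have "emeasure (\<Pi>\<^sub>M i\<in>I. M) F
      = emeasure ((\<Pi>\<^sub>M i\<in>J. M) \<Otimes>\<^sub>M (\<Pi>\<^sub>M i\<in>I - J. M))
          (merge J (I - J) -` F \<inter> space ((\<Pi>\<^sub>M i\<in>J. M) \<Otimes>\<^sub>M (\<Pi>\<^sub>M i\<in>I - J. M)))"
    using distr_merge[OF I(2) fin] I F emeasure_distr measurable_merge by metis
  also have "merge J (I - J) -` F \<inter> space ((\<Pi>\<^sub>M i\<in>J. M) \<Otimes>\<^sub>M (\<Pi>\<^sub>M i\<in>I - J. M))
      = E \<times> space (\<Pi>\<^sub>M i\<in>I - J. M)"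
  proof -
    have "merge J (I - J) p \<in> space (\<Pi>\<^sub>M i\<in>I. M)"
      if "p \<in> space ((\<Pi>\<^sub>M i\<in>J. M) \<Otimes>\<^sub>M (\<Pi>\<^sub>M i\<in>I - J. M))" for p
      using measurable_space[OF measurable_merge that] I by metis
    moreover have "?r (merge J (I - J) (x, y)) = x" if "x \<in> space (\<Pi>\<^sub>M i\<in>J. M)" for x y
      using that by (auto simp: space_PiM PiE_restrict)
    moreover have "E \<subseteq> space (\<Pi>\<^sub>M i\<in>J. M)"
      using E by (auto dest: sets.sets_into_space)
    ultimately show ?thesis
      by (fastforce simp: F_def space_pair_measure)
  qed
  \<comment> \<open>The second factor may have infinite measure; the product is still 0 since
    \<open>0 * \<infinity> = 0\<close>.\<close>
  also have "emeasure ((\<Pi>\<^sub>M i\<in>J. M) \<Otimes>\<^sub>M (\<Pi>\<^sub>M i\<in>I - J. M)) \<dots> = 0"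
    using E by (subst D.emeasure_pair_measure_Times) auto
  finally have "F \<in> null_sets (\<Pi>\<^sub>M i\<in>I. M)"
    using F by auto
  moreover have "{x \<in> space (\<Pi>\<^sub>M i\<in>I. M). \<not> P (?r x)} \<subseteq> F"
    using E(2) measurable_space[OF r] by (auto simp: F_def)
  ultimately show ?thesis
    unfolding eventually_ae_filter by blast
qed

text \<open>By Fubini, for a.e. \<open>x\<close> the statement holds for a.e. choice of the
  remaining coordinates. It does not involve them, so it holds at \<open>x\<close> as soon as their
  measure is nonzero.\<close>

lemma AE_PiM_restrictD:
  assumes "sigma_finite_measure M" and "emeasure M (space M) > 0" and "finite I" and "J \<subseteq> I"
    and "AE x in \<Pi>\<^sub>M i\<in>I. M. P (restrict x J)"
  shows "AE x in \<Pi>\<^sub>M i\<in>J. M. P x"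
proof -
  interpret product_sigma_finite "\<lambda>_. M"
    using assms by (simp add: product_sigma_finite_def)
  have fin: "finite J" "finite (I - J)" and I: "J \<union> (I - J) = I" "J \<inter> (I - J) = {}"
    using assms finite_subset by auto
  interpret pair_sigma_finite "\<Pi>\<^sub>M i\<in>J. M" "\<Pi>\<^sub>M i\<in>I - J. M"
    using fin by (auto simp: pair_sigma_finite_def intro: sigma_finite)
  \<comment> \<open>A finite product of positive factors is positive; on a zero measure every
    statement would hold a.e.\<close>
  have "emeasure (\<Pi>\<^sub>M i\<in>I - J. M) (space (\<Pi>\<^sub>M i\<in>I - J. M)) \<noteq> 0"
    using assms(2) fin by (auto simp: space_PiM emeasure_PiM)
  then have nontriv: "ae_filter (\<Pi>\<^sub>M i\<in>I - J. M) \<noteq> bot"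
    by (simp add: ae_filter_eq_bot_iff)
  have "AE p in (\<Pi>\<^sub>M i\<in>J. M) \<Otimes>\<^sub>M (\<Pi>\<^sub>M i\<in>I - J. M). P (restrict (merge J (I - J) p) J)"
    by (rule AE_distrD[OF measurable_merge]) (subst distr_merge[OF I(2) fin], unfold I(1), rule assms(5))
  from AE_pair[OF this] show ?thesis
    by (rule AE_mp) (use nontriv in \<open>auto intro!: AE_I2 simp: space_PiM PiE_restrict eventually_const\<close>)
qed

lemma AE_PiM_reindex:
  fixes M :: "'a measure" and I :: "'i set" and J :: "'j set"
  assumes "sigma_finite_measure M" and "finite I" and "inj_on t J" and "t ` J \<subseteq> I"
    and "AE x in \<Pi>\<^sub>M j\<in>J. M. P x"
  shows "AE x in \<Pi>\<^sub>M i\<in>I. M. P (\<lambda>j\<in>J. x (t j))"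
proof -
  interpret product_sigma_finite "\<lambda>_. M"
    using assms by (simp add: product_sigma_finite_def)
  have fin: "finite J" "finite (t ` J)"
    using assms finite_subset finite_imageD by blast+
  define r where "r x = (\<lambda>j\<in>J. x (t j))" for x :: "'i \<Rightarrow> 'a"
  have r: "r \<in> (\<Pi>\<^sub>M i\<in>t ` J. M) \<rightarrow>\<^sub>M (\<Pi>\<^sub>M j\<in>J. M)"
    unfolding r_def by (intro measurable_restrict measurable_component_singleton) simp
  have "distr (\<Pi>\<^sub>M i\<in>t ` J. M) (\<Pi>\<^sub>M j\<in>J. M) r = (\<Pi>\<^sub>M j\<in>J. M)"
  proof (rule PiM_eqI)
    fix A assume A: "\<And>j. j \<in> J \<Longrightarrow> A j \<in> sets M"
    let ?B = "\<lambda>i. A (the_inv_into J t i)"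
    have inv: "the_inv_into J t (t j) = j" if "j \<in> J" for j
      using assms(3) that by (rule the_inv_into_f_f)
    have AM: "v \<in> space M" if "v \<in> A j" "j \<in> J" for v j
      using A[OF that(2)] that(1) by (auto dest: sets.sets_into_space)
    \<comment> \<open>A box pulls back to the box with sides relabelled by the inverse of
      \<open>t\<close>. Agreement on boxes determines the product measure.\<close>
    have "r -` Pi\<^sub>E J A \<inter> space (\<Pi>\<^sub>M i\<in>t ` J. M) = Pi\<^sub>E (t ` J) ?B"
      by (auto simp: r_def space_PiM PiE_iff inv) (metis AM)
    then have "emeasure (distr (\<Pi>\<^sub>M i\<in>t ` J. M) (\<Pi>\<^sub>M j\<in>J. M) r) (Pi\<^sub>E J A)
        = emeasure (\<Pi>\<^sub>M i\<in>t ` J. M) (Pi\<^sub>E (t ` J) ?B)"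
      using A fin r by (simp add: emeasure_distr sets_PiM_I_finite)
    also have "\<dots> = (\<Prod>i\<in>t ` J. emeasure M (?B i))"
      using A fin inv by (intro emeasure_PiM) auto
    also have "\<dots> = (\<Prod>j\<in>J. emeasure M (A j))"
      using assms(3) inv by (simp add: prod.reindex)
    finally show "emeasure (distr (\<Pi>\<^sub>M i\<in>t ` J. M) (\<Pi>\<^sub>M j\<in>J. M) r) (Pi\<^sub>E J A)
        = (\<Prod>j\<in>J. emeasure M (A j))" .
  qed (use fin in simp_all)
  then have "AE x in \<Pi>\<^sub>M i\<in>t ` J. M. P (r x)"
    by (intro AE_distrD[OF r]) (erule ssubst, rule assms(5))
  from AE_PiM_restrict[OF assms(1,2,4) this] show ?thesis
    by (simp add: r_def cong: restrict_cong)
qed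

section \<open>Selecting coordinates from a larger power\<close>

text \<open>The selections along which a.e. statements pull back. Taking extensional functions makes
  this set finite.\<close>

definition injective_tuples :: "nat \<Rightarrow> nat \<Rightarrow> (nat \<Rightarrow> nat) set" where
  "injective_tuples k K = {t \<in> {1..k} \<rightarrow>\<^sub>E {1..K}. inj_on t {1..k}}"

lemma finite_injective_tuples: "finite (injective_tuples k K)"
  unfolding injective_tuples_def by (simp add: finite_PiE)

lemma increasing_indices_subset: "increasing_indices m N \<subseteq> injective_tuples m N"
  unfolding increasing_indices_def injective_tuples_def
  by (auto intro: strict_mono_on_imp_inj_on)

lemma finite_increasing_indices: "finite (increasing_indices m N)"
  using increasing_indices_subset finite_injective_tuples by (rule finite_subset)

lemma AE_power_measure_iff: "(AE x in power_measure M k. P x) \<longleftrightarrow> (AE x in \<Pi>\<^sub>M i\<in>{1..k}. M. P x)"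
  unfolding power_measure_def by (rule AE_completion_iff)

text \<open>Each injective selection pulls null sets back to null sets, and a finite union of these
  is null, so one generic \<open>z\<close> serves all selections.\<close>

lemma AE_power_measure_tuples:
  assumes "sigma_finite_measure M" and "AE x in power_measure M k. P x"
  shows "AE z in power_measure M K. \<forall>t\<in>injective_tuples k K. P (\<lambda>j\<in>{1..k}. z (t j))"
proof (rule AE_finite_allI[OF finite_injective_tuples])
  fix t assume "t \<in> injective_tuples k K"
  then have "inj_on t {1..k}" "t ` {1..k} \<subseteq> {1..K}"
    by (auto simp: injective_tuples_def)
  then show "AE z in power_measure M K. P (\<lambda>j\<in>{1..k}. z (t j))"
    using AE_PiM_reindex[OF assms(1), of "{1..K}" t "{1..k}" P] assms(2)
    by (simp add: AE_power_measure_iff)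
qed

section \<open>Means and kernels at a single point\<close>

text \<open>With finite terms the convention for opposite infinities never enters, so the sum can be
  taken in the reals; the form of the result also shows that the mean is finite.\<close>

lemma generalized_mean_eq_ereal:
  assumes "\<And>i. i \<in> increasing_indices m N \<Longrightarrow> \<bar>u (\<lambda>j\<in>{1..m}. x (i j))\<bar> \<noteq> \<infinity>"
  shows "generalized_mean m N u x = ereal (1 / real (N choose m) *
    (\<Sum>i\<in>increasing_indices m N. real_of_ereal (u (\<lambda>j\<in>{1..m}. x (i j)))))"
proof -
  have "(\<Sum>i\<in>increasing_indices m N. u (\<lambda>j\<in>{1..m}. x (i j)))
      = (\<Sum>i\<in>increasing_indices m N. ereal (real_of_ereal (u (\<lambda>j\<in>{1..m}. x (i j)))))"
    using assms by (intro sum.cong) (simp_all add: ereal_real')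
  then show ?thesis
    by (simp add: generalized_mean_def)
qed

lemma tendsto_generalized_mean:
  assumes "\<And>n i. i \<in> increasing_indices m N \<Longrightarrow> \<bar>u n (\<lambda>j\<in>{1..m}. x (i j))\<bar> \<noteq> \<infinity>"
    and "\<And>i. i \<in> increasing_indices m N \<Longrightarrow> \<bar>v (\<lambda>j\<in>{1..m}. x (i j))\<bar> \<noteq> \<infinity>"
    and "\<And>i. i \<in> increasing_indices m N \<Longrightarrow>
      (\<lambda>n. u n (\<lambda>j\<in>{1..m}. x (i j))) \<longlonglongrightarrow> v (\<lambda>j\<in>{1..m}. x (i j))"
  shows "(\<lambda>n. generalized_mean m N (u n) x) \<longlonglongrightarrow> generalized_mean m N v x"
proof -
  have "(\<lambda>n. real_of_ereal (u n (\<lambda>j\<in>{1..m}. x (i j)))) \<longlonglongrightarrow> real_of_ereal (v (\<lambda>j\<in>{1..m}. x (i j)))"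
    if "i \<in> increasing_indices m N" for i
    \<comment> \<open>Convergence passes to \<open>real_of_ereal\<close> because the limit is
      finite.\<close>
    using assms(2,3)[OF that] by (intro lim_real_of_ereal) (simp add: ereal_real')
  then have "(\<lambda>n. 1 / real (N choose m) *
        (\<Sum>i\<in>increasing_indices m N. real_of_ereal (u n (\<lambda>j\<in>{1..m}. x (i j)))))
      \<longlonglongrightarrow> 1 / real (N choose m) *
        (\<Sum>i\<in>increasing_indices m N. real_of_ereal (v (\<lambda>j\<in>{1..m}. x (i j))))"
    by (intro tendsto_mult tendsto_const tendsto_sum)
  moreover note generalized_mean_eq_ereal[of m N v x, OF assms(2)]
  moreover have "generalized_mean m N (u n) x = ereal (1 / real (N choose m) *
      (\<Sum>i\<in>increasing_indices m N. real_of_ereal (u n (\<lambda>j\<in>{1..m}. x (i j)))))" for n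
    using assms(1) by (rule generalized_mean_eq_ereal)
  ultimately show ?thesis
    by (simp only: lim_ereal)
qed

text \<open>For fixed \<open>z\<close>, the labels 1 to \<open>K\<close> stand for its coordinates,
  and \<open>convergent_sum_listD\<close> is applied to labels. Distinctness is thus asked of
  labels, and equal coordinates of \<open>z\<close> do no harm.\<close>

lemma kernel_tendsto_of_means_tendsto:
  fixes u :: "nat \<Rightarrow> (nat \<Rightarrow> 'a) \<Rightarrow> ereal" and z :: "nat \<Rightarrow> 'a"
  assumes "m \<le> N" and K: "K = N + 2 * m"
    and fin: "\<And>n s. s \<in> injective_tuples m K \<Longrightarrow> \<bar>u n (\<lambda>j\<in>{1..m}. z (s j))\<bar> \<noteq> \<infinity>"
    and V: "\<And>t. t \<in> injective_tuples N K \<Longrightarrow> \<bar>V (\<lambda>j\<in>{1..N}. z (t j))\<bar> \<noteq> \<infinity>"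
    and conv: "\<And>t. t \<in> injective_tuples N K \<Longrightarrow>
      (\<lambda>n. generalized_mean m N (u n) (\<lambda>j\<in>{1..N}. z (t j))) \<longlonglongrightarrow> V (\<lambda>j\<in>{1..N}. z (t j))"
  shows "\<exists>r::real. (\<lambda>n. u n (restrict z {1..m})) \<longlonglongrightarrow> ereal r"
proof -
  let ?A = "increasing_indices m N"
  \<comment> \<open>List positions start at 0 and arguments at 1, hence
    \<open>j - 1\<close>.\<close>
  define f where "f n l = real_of_ereal (u n (\<lambda>j\<in>{1..m}. z (l ! (j - 1))))" for n and l :: "nat list"
  define idx where "idx i = map i [1..<Suc m]" for i :: "nat \<Rightarrow> nat"
  have "(\<lambda>j\<in>{1..m}. j) \<in> ?A"
    using \<open>m \<le> N\<close> by (auto simp: increasing_indices_def strict_mono_on_def)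
  then have ne: "?A \<noteq> {}" by blast
  \<comment> \<open>The labels 1 to \<open>m\<close> select the first \<open>m\<close> coordinates
    of \<open>z\<close>, the point at which the kernel is to converge.\<close>
  have "convergent (\<lambda>n. f n [1..<Suc m])"
  proof (rule convergent_sum_listD[where A = ?A and idx = idx and I = "{1..N}" and K = "{1..K}"])
    fix i assume "i \<in> ?A"
    then have i: "\<And>j. 1 \<le> j \<Longrightarrow> j \<le> m \<Longrightarrow> i j \<in> {1..N}"
        "\<And>j k. 1 \<le> j \<Longrightarrow> j < k \<Longrightarrow> k \<le> m \<Longrightarrow> i j < i k"
      by (auto simp: increasing_indices_def strict_mono_on_def)
    show "sorted_wrt (<) (idx i)"
      unfolding idx_def sorted_wrt_iff_nth_less by (auto intro: i simp del: upt_Suc)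
    show "set (idx i) \<subseteq> {1..N}"
      unfolding idx_def using i by auto
  next
    fix t :: "nat \<Rightarrow> nat" assume t: "inj_on t {1..N}" "t ` {1..N} \<subseteq> {1..K}"
    define x where "x = (\<lambda>j\<in>{1..N}. z (t j))"
    have tt: "restrict t {1..N} \<in> injective_tuples N K"
      using t by (auto simp: injective_tuples_def inj_on_restrict_eq)
    have x: "x = (\<lambda>j\<in>{1..N}. z (restrict t {1..N} j))"
      by (auto simp: x_def)
    have lim: "(\<lambda>n. generalized_mean m N (u n) x) \<longlonglongrightarrow> V x" "\<bar>V x\<bar> \<noteq> \<infinity>"
      unfolding x using conv[OF tt] V[OF tt] by auto
    \<comment> \<open>The first equation matches the terms of the mean with \<open>f\<close>; the
      other two facts exhibit the same point as an injective selection from \<open>z\<close>, where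
      \<open>fin\<close> applies.\<close>
    have x_i: "(\<lambda>j\<in>{1..m}. x (i j)) = (\<lambda>j\<in>{1..m}. z (map t (idx i) ! (j - 1)))"
      "(\<lambda>j\<in>{1..m}. x (i j)) = (\<lambda>j\<in>{1..m}. z ((\<lambda>j\<in>{1..m}. t (i j)) j))"
      "(\<lambda>j\<in>{1..m}. t (i j)) \<in> injective_tuples m K" if "i \<in> ?A" for i
    proof -
      have i: "i \<in> {1..m} \<rightarrow> {1..N}" "inj_on i {1..m}"
        using that increasing_indices_subset by (fastforce simp: injective_tuples_def)+
      show "(\<lambda>j\<in>{1..m}. x (i j)) = (\<lambda>j\<in>{1..m}. z (map t (idx i) ! (j - 1)))"
        using i by (intro restrict_ext) (auto simp: x_def idx_def nth_append simp del: upt_Suc)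
      show "(\<lambda>j\<in>{1..m}. x (i j)) = (\<lambda>j\<in>{1..m}. z ((\<lambda>j\<in>{1..m}. t (i j)) j))"
        using i by (intro restrict_ext) (auto simp: x_def)
      have "inj_on t (i ` {1..m})"
        using t(1) by (rule inj_on_subset) (use i(1) in blast)
      then have "inj_on (\<lambda>j. t (i j)) {1..m}"
        using comp_inj_on[OF i(2)] by (simp add: comp_def)
      moreover have "t (i j) \<in> {1..K}" if "j \<in> {1..m}" for j
        using that i(1) t(2) by blast
      ultimately show "(\<lambda>j\<in>{1..m}. t (i j)) \<in> injective_tuples m K"
        by (auto simp: injective_tuples_def inj_on_restrict_eq)
    qed
    have "\<bar>u n (\<lambda>j\<in>{1..m}. x (i j))\<bar> \<noteq> \<infinity>" if "i \<in> ?A" for i n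
      using fin[OF x_i(3)[OF that]] x_i(2)[OF that] by metis
    then have "generalized_mean m N (u n) x
        = ereal (1 / real (N choose m) * (\<Sum>i\<in>?A. f n (map t (idx i))))" for n
      by (subst generalized_mean_eq_ereal) (simp_all add: f_def x_i(1) del: One_nat_def)
    \<comment> \<open>A finite limit \<open>V x\<close> turns convergence in the extended reals into
      convergence of real sequences.\<close>
    then have "convergent (\<lambda>n. 1 / real (N choose m) * (\<Sum>i\<in>?A. f n (map t (idx i))))"
      using lim by (cases "V x") (auto simp: convergent_def)
    moreover have "1 / real (N choose m) \<noteq> 0"
      using \<open>m \<le> N\<close> by simp
    ultimately show "convergent (\<lambda>n. \<Sum>i\<in>?A. f n (map t (idx i)))"
      using convergent_mult_const_iff by blast
  qed (use ne K in \<open>auto simp: finite_increasing_indices idx_def\<close>)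
  then obtain r where "(\<lambda>n. f n [1..<Suc m]) \<longlonglongrightarrow> r"
    by (auto simp: convergent_def)
  then have "(\<lambda>n. ereal (f n [1..<Suc m])) \<longlonglongrightarrow> ereal r"
    by simp
  \<comment> \<open>The kernels are finite at this point, so \<open>real_of_ereal\<close> in
    \<open>f\<close> loses nothing.\<close>
  moreover have "ereal (f n [1..<Suc m]) = u n (restrict z {1..m})" for n
  proof -
    have "(\<lambda>j\<in>{1..m}. j) \<in> injective_tuples m K"
      using K by (auto simp: injective_tuples_def inj_on_def)
    moreover have "(\<lambda>j\<in>{1..m}. z ((\<lambda>j\<in>{1..m}. j) j)) = restrict z {1..m}"
      by (intro restrict_ext) simp
    ultimately have "\<bar>u n (restrict z {1..m})\<bar> \<noteq> \<infinity>"
      using fin by metis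
    moreover have "(\<lambda>j\<in>{1..m}. z ([1..<Suc m] ! (j - 1))) = restrict z {1..m}"
      by (intro restrict_ext) (auto simp del: upt_Suc)
    ultimately show ?thesis
      by (simp add: f_def ereal_real' del: upt_Suc)
  qed
  ultimately show ?thesis by (simp only:) (rule exI)
qed

section \<open>Almost everywhere convergence of means and of kernels\<close>

theorem theorem3:
  fixes M :: "'a measure" and m N :: nat
    and u U :: "nat \<Rightarrow> (nat \<Rightarrow> 'a) \<Rightarrow> ereal"
  assumes "sigma_finite_measure M" and "complete_measure M"
    and "emeasure M (space M) > 0"
    and "1 \<le> m" and "m \<le> N"
    and "\<And>n. ae_finite M m (u n)"
    and "\<And>n. AE x in power_measure M N. U n x = generalized_mean m N (u n) x"
  shows "((\<exists>V. ae_finite M N V \<and> (AE x in power_measure M N. (\<lambda>n. U n x) \<longlonglongrightarrow> V x)) \<longleftrightarrow>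
          (\<exists>v. ae_finite M m v \<and> (AE x in power_measure M m. (\<lambda>n. u n x) \<longlonglongrightarrow> v x)))
       \<and> (\<forall>V v. ae_finite M N V \<longrightarrow> (AE x in power_measure M N. (\<lambda>n. U n x) \<longlonglongrightarrow> V x) \<longrightarrow>
            ae_finite M m v \<longrightarrow> (AE x in power_measure M m. (\<lambda>n. u n x) \<longlonglongrightarrow> v x) \<longrightarrow>
            (AE x in power_measure M N. V x = generalized_mean m N v x))"
proof -
  have U: "AE x in power_measure M N. \<forall>n. U n x = generalized_mean m N (u n) x"
    using assms(7) by (simp add: AE_all_countable)
  have u_fin: "AE x in power_measure M m. \<forall>n. \<bar>u n x\<bar> \<noteq> \<infinity>"
    using assms(6) by (simp add: AE_all_countable ae_finite_def)
  \<comment> \<open>Serves twice: it supplies a finite limit of the means, and it identifies every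
    such limit.\<close>
  have mean: "AE x in power_measure M N. (\<lambda>n. U n x) \<longlonglongrightarrow> generalized_mean m N v x
      \<and> \<bar>generalized_mean m N v x\<bar> \<noteq> \<infinity>"
    if v: "ae_finite M m v" "AE x in power_measure M m. (\<lambda>n. u n x) \<longlonglongrightarrow> v x" for v
  proof -
    have "AE x in power_measure M m. (\<forall>n. \<bar>u n x\<bar> \<noteq> \<infinity>) \<and> \<bar>v x\<bar> \<noteq> \<infinity> \<and> (\<lambda>n. u n x) \<longlonglongrightarrow> v x"
      using u_fin v by (simp add: ae_finite_def)
    from AE_power_measure_tuples[OF assms(1) this, of N] U show ?thesis
    proof eventually_elim
      case (elim x)
      have *: "(\<forall>n. \<bar>u n (\<lambda>j\<in>{1..m}. x (i j))\<bar> \<noteq> \<infinity>) \<and> \<bar>v (\<lambda>j\<in>{1..m}. x (i j))\<bar> \<noteq> \<infinity>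
          \<and> (\<lambda>n. u n (\<lambda>j\<in>{1..m}. x (i j))) \<longlonglongrightarrow> v (\<lambda>j\<in>{1..m}. x (i j))"
        if "i \<in> increasing_indices m N" for i
        by (rule bspec[OF elim(1) subsetD[OF increasing_indices_subset that]])
      then show ?case
        using tendsto_generalized_mean[of m N u x v] generalized_mean_eq_ereal[of m N v x] elim(2)
        by simp
    qed
  qed
  have kernel: "\<exists>v. ae_finite M m v \<and> (AE x in power_measure M m. (\<lambda>n. u n x) \<longlonglongrightarrow> v x)"
    if V: "ae_finite M N V" "AE x in power_measure M N. (\<lambda>n. U n x) \<longlonglongrightarrow> V x" for V
  proof -
    define K where "K = N + 2 * m"
    have "AE x in power_measure M N. \<bar>V x\<bar> \<noteq> \<infinity> \<and> (\<lambda>n. generalized_mean m N (u n) x) \<longlonglongrightarrow> V x"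
      using V(1)[unfolded ae_finite_def] V(2) U by eventually_elim simp
    \<comment> \<open>At a.e. \<open>z\<close> the means converge at all selected points of order
      \<open>N\<close> and all kernels are finite at the selected points of order
      \<open>m\<close>.\<close>
    from AE_power_measure_tuples[OF assms(1) this, of K] AE_power_measure_tuples[OF assms(1) u_fin, of K]
    have "AE z in power_measure M K. \<exists>r::real. (\<lambda>n. u n (restrict z {1..m})) \<longlonglongrightarrow> ereal r"
    proof eventually_elim
      case (elim z)
      show ?case
      proof (rule kernel_tendsto_of_means_tendsto[where V = V, OF \<open>m \<le> N\<close> K_def])
        show "\<bar>u n (\<lambda>j\<in>{1..m}. z (s j))\<bar> \<noteq> \<infinity>" if "s \<in> injective_tuples m K" for n s
          by (rule bspec[OF elim(2) that, THEN spec])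
        show "\<bar>V (\<lambda>j\<in>{1..N}. z (t j))\<bar> \<noteq> \<infinity>" if "t \<in> injective_tuples N K" for t
          by (rule bspec[OF elim(1) that, THEN conjunct1])
        show "(\<lambda>n. generalized_mean m N (u n) (\<lambda>j\<in>{1..N}. z (t j))) \<longlonglongrightarrow> V (\<lambda>j\<in>{1..N}. z (t j))"
          if "t \<in> injective_tuples N K" for t
          by (rule bspec[OF elim(1) that, THEN conjunct2])
      qed
    qed
    \<comment> \<open>The statement involves only the first \<open>m\<close> coordinates of
      \<open>z\<close>; positivity of the total measure allows the descent.\<close>
    then have "AE x in power_measure M m. \<exists>r::real. (\<lambda>n. u n x) \<longlonglongrightarrow> ereal r"
      unfolding AE_power_measure_iff
      by (rule AE_PiM_restrictD[OF assms(1,3), rotated 2]) (simp_all add: K_def)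
    \<comment> \<open>The limit is chosen point by point. Where none exists the value is arbitrary
      but real, so the chosen kernel is finite everywhere.\<close>
    then have ex: "AE x in power_measure M m. (\<lambda>n. u n x) \<longlonglongrightarrow> ereal (SOME r. (\<lambda>n. u n x) \<longlonglongrightarrow> ereal r)"
      by eventually_elim (rule someI_ex)
    show ?thesis
      by (intro exI[of _ "\<lambda>x. ereal (SOME r. (\<lambda>n. u n x) \<longlonglongrightarrow> ereal r)"] conjI ex) (simp add: ae_finite_def)
  qed
  have "AE x in power_measure M N. V x = generalized_mean m N v x"
    if "AE x in power_measure M N. (\<lambda>n. U n x) \<longlonglongrightarrow> V x" "ae_finite M m v"
      "AE x in power_measure M m. (\<lambda>n. u n x) \<longlonglongrightarrow> v x" for V v
    using mean[OF that(2,3)] that(1) by eventually_elim (blast intro: LIMSEQ_unique)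
  moreover have "\<exists>V. ae_finite M N V \<and> (AE x in power_measure M N. (\<lambda>n. U n x) \<longlonglongrightarrow> V x)"
    if "ae_finite M m v" "AE x in power_measure M m. (\<lambda>n. u n x) \<longlonglongrightarrow> v x" for v
    using mean[OF that] by (auto simp: ae_finite_def)
  ultimately show ?thesis
    using kernel by blast
qed

end
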